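(* Let $G$ be a finite simple undirected connected graph with $\delta(G)=2$. Then $\gamma_t(G)=2\mu^*(G)$ if and only if either $G\in\mathcal{K}\cup\{C_6\}$ (up to isomorphism), or $G\notin\mathcal{K}\cup\{C_6\}$ and the edge set $\mathcal{M}=\mathcal{M}(G)$ is a maximal matching of $G$ satisfying the following two conditions: (i) For every $v\in V(\mathcal{M})$, $\mathcal{M}_p(v)$ is the unique neighbor of $v$ among the vertices of $V(\mathcal{M})$. (ii) For every two distinct vertices $u$ and $v$ in $V(\mathcal{M})$, whenever $u$ and $v$ share a neighbor in $G$, there exists a vertex of $G$ whose neighborhood is exactly $\{\mathcal{M}_p(u),\mathcal{M}_p(v)\}$.
   Context: $\delta(G)$ is the minimum degree of $G$. A set $S\subseteq V(G)$ is a total dominating set of $G$ if every vertex of $V(G)$ (including those in $S$) is adjacent to a member of $S$; $\gamma_t(G)$ is the minimum cardinality of a total dominating set (defined when $G$ has no isolated vertices). A matching is a set of pairwise disjoint edges; a maximal matching is a matching not contained in a larger matching; $\mu^*(G)$ is the minimum cardinality of a maximal matching of $G$. $C_6$ is the cycle of length 6. $\mathcal{K}$ is the family of graphs isomorphic to a graph with vertex set $\{u,v,w_1,\dots,w_n\}$ and edge set $\{uv,uw_1,vw_1,\dots,uw_n,vw_n\}$ for some positive integer $n$ (triangles sharing a common edge). $N(v)$ is the set of neighbors of $v$, and $d_2(G)$ is the set of vertices of $G$ of degree two. For a connected graph $G\notin\mathcal{K}\cup\{C_6\}$, $\mathcal{M}(G)$ is the set of edges $uv$ of $G$ such that there exist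 $x\in N(u)\cap d_2(G)$ and $y\in N(v)\cap d_2(G)$ so that the edges $xu,uv,vy$ belong to the same induced cycle $C_6$ in $G$. Equivalently, for all distinct $x,y\in d_2(G)$ such that the subgraph of $G$ induced by $N(x)\cup N(y)\cup\{x,y\}$ is a $C_6$, the two edges of this cycle incident to neither $x$ nor $y$ are put in $\mathcal{M}(G)$. For a matching $M$, $V(M)$ is the set of endpoints of the edges in $M$, and for $w\in V(M)$, $M_p(w)$ denotes the other endpoint of the edge of $M$ containing $w$; $\mathcal{M}_p$ is this notation for $M=\mathcal{M}$. *)

theory Defs
  imports "Graph_Theory.Digraph_Isomorphism"
begin

text \<open>
  A finite simple undirected graph is a \<^locale>\<open>pair_graph\<close>, that is, a
  finite loop-free digraph with a symmetric arc relation. An undirected edge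
  is the two-element set of its endpoints.
\<close>

definition uedges :: "'a pair_pre_digraph \<Rightarrow> 'a set set" where
  "uedges G = {{u, v} | u v. (u, v) \<in> parcs G}"

definition nbhd :: "'a pair_pre_digraph \<Rightarrow> 'a \<Rightarrow> 'a set" where
  "nbhd G v = {w. (v, w) \<in> parcs G}"

definition degree :: "'a pair_pre_digraph \<Rightarrow> 'a \<Rightarrow> nat" where
  "degree G v = card (nbhd G v)"

definition min_degree :: "'a pair_pre_digraph \<Rightarrow> nat" where
  "min_degree G = Min (degree G ` pverts G)"

definition d2 :: "'a pair_pre_digraph \<Rightarrow> 'a set" where
  "d2 G = {v \<in> pverts G. degree G v = 2}"


definition total_dominating :: "'a pair_pre_digraph \<Rightarrow> 'a set \<Rightarrow> bool" where
  "total_dominating G S \<longleftrightarrow> S \<subseteq> pverts G \<and> (\<forall>v \<in> pverts G. \<exists>u \<in> S. (v, u) \<in> parcs G)"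

text \<open>Meaningful for finite graphs without isolated vertices; otherwise the \<^const>\<open>Min\<close> is taken
  over the empty set.\<close>
definition total_domination_number :: "'a pair_pre_digraph \<Rightarrow> nat" where
  "total_domination_number G = Min (card ` {S. total_dominating G S})"

definition matching :: "'a pair_pre_digraph \<Rightarrow> 'a set set \<Rightarrow> bool" where
  "matching G M \<longleftrightarrow> M \<subseteq> uedges G \<and> pairwise disjnt M"

definition maximal_matching :: "'a pair_pre_digraph \<Rightarrow> 'a set set \<Rightarrow> bool" where
  "maximal_matching G M \<longleftrightarrow> matching G M \<and> \<not> (\<exists>M'. matching G M' \<and> M \<subset> M')"

definition min_maximal_matching_number :: "'a pair_pre_digraph \<Rightarrow> nat" where
  "min_maximal_matching_number G = Min (card ` {M. maximal_matching G M})"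

definition matching_verts :: "'a set set \<Rightarrow> 'a set" where
  "matching_verts M = \<Union> M"

definition partner :: "'a set set \<Rightarrow> 'a \<Rightarrow> 'a" where
  "partner M w = (THE z. {w, z} \<in> M)"


definition cycle6 :: "nat pair_pre_digraph" where
  "cycle6 = \<lparr> pverts = {..<6},
     parcs = {(i, j). i < 6 \<and> j < 6 \<and> (j = (i + 1) mod 6 \<or> i = (j + 1) mod 6)} \<rparr>"

text \<open>The vertices \<open>u\<close> and \<open>v\<close> are \<open>0\<close> and \<open>1\<close>; the vertices \<open>w\<^sub>1, \<dots>, w\<^sub>n\<close> are \<open>2, \<dots>, n + 1\<close>.\<close>
definition triangle_book :: "nat \<Rightarrow> nat pair_pre_digraph" where
  "triangle_book n = \<lparr> pverts = {..<n + 2},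
     parcs = {(i, j). i < n + 2 \<and> j < n + 2 \<and> i \<noteq> j \<and> (i < 2 \<or> j < 2)} \<rparr>"

definition in_K_family :: "'a pair_pre_digraph \<Rightarrow> bool" where
  "in_K_family G \<longleftrightarrow> (\<exists>n \<ge> 1. digraph_iso (with_proj G) (with_proj (triangle_book n)))"

definition is_C6 :: "'a pair_pre_digraph \<Rightarrow> bool" where
  "is_C6 G \<longleftrightarrow> digraph_iso (with_proj G) (with_proj cycle6)"


text \<open>
  The conditions \<open>x \<noteq> v\<close> and \<open>y \<noteq> u\<close> say that \<open>xu\<close>, \<open>uv\<close>, \<open>vy\<close> are three different edges of the
  cycle \<open>H\<close>; hence \<open>x\<close> and \<open>y\<close> are opposite vertices of \<open>H\<close>, and \<open>uv\<close> is incident to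
  neither of them. The set is used only for graphs outside \<open>\<K> \<union> {C\<^sub>6}\<close>.
\<close>
definition M_edges :: "'a pair_pre_digraph \<Rightarrow> 'a set set" where
  "M_edges G = {{u, v} | u v. {u, v} \<in> uedges G \<and>
     (\<exists>x \<in> nbhd G u \<inter> d2 G. \<exists>y \<in> nbhd G v \<inter> d2 G. x \<noteq> v \<and> y \<noteq> u \<and>
        (\<exists>H. induced_subgraph (with_proj H) (with_proj G) \<and> is_C6 H \<and>
           {{x, u}, {u, v}, {v, y}} \<subseteq> uedges H))}"

end

theory Submission
  imports Defs
begin

text \<open>
  Call a maximal matching tight if it satisfies (i) and (ii). The vertices of a maximal matching \<open>M\<close>
  form a total dominating set, hence \<open>\<gamma>\<^sub>t \<le> 2\<mu>\<^sup>*\<close>, and equality holds iff a tight matching exists.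
  If \<open>V(M)\<close> is a minimum total dominating set, then \<open>V(M) - {M\<^sub>p(v)}\<close> is not total dominating, which
  gives (i), and for \<open>u, v\<close> with a common neighbor \<open>w\<close> neither is
  \<open>V(M) - {M\<^sub>p(u), M\<^sub>p(v)} \<union> {w}\<close>; a vertex that it fails to dominate has neighborhood
  \<open>{M\<^sub>p(u), M\<^sub>p(v)}\<close>, which gives (ii). Conversely, for tight \<open>M\<close> and a total dominating set \<open>D\<close>, map
  \<open>x \<in> V(M)\<close> to its partner if that lies in \<open>D\<close> and to any dominator in \<open>D - V(M)\<close> otherwise: (ii) makes
  this map injective, so \<open>2|M| \<le> |D|\<close>.

  Finally, outside \<open>\<K> \<union> {C\<^sub>6}\<close> the only tight matching is \<open>\<M>(G)\<close>. By connectedness, an end of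
  an edge of a tight matching shares a neighbor with an end of another edge, and two uses of (ii) produce
  the hexagon; conversely, an edge of \<open>\<M>(G)\<close> outside a tight matching would force \<open>G = C\<^sub>6\<close>.
\<close>

subsection \<open>Isomorphism with hexagons and triangle books\<close>

text \<open>Arcs here are ordered pairs of their endpoints, so an isomorphism is determined by its
  vertex map. The bijection runs from \<open>H\<close> to \<open>G\<close>, so that a numbered model
  graph \<open>H\<close> labels the vertices of \<open>G\<close>.\<close>

lemma digraph_iso_with_proj_iff:
  assumes "pair_wf_digraph G" and "pair_wf_digraph H"
  shows "digraph_iso (with_proj G) (with_proj H) \<longleftrightarrow>
    (\<exists>g. bij_betw g (pverts H) (pverts G) \<and>
      (\<forall>i \<in> pverts H. \<forall>j \<in> pverts H. (i, j) \<in> parcs H \<longleftrightarrow> (g i, g j) \<in> parcs G))"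
    (is "?L \<longleftrightarrow> ?R")
proof
  interpret G: pair_wf_digraph G by fact
  interpret H: pair_wf_digraph H by fact
  {
    assume ?L
    then obtain h where iso: "pre_digraph.digraph_isomorphism (with_proj G) h"
      and H: "with_proj H = app_iso h (with_proj G)"
      unfolding digraph_iso_def by blast
    let ?f = "iso_verts h"
    have inj: "inj_on ?f (pverts G)"
      using iso by (simp add: pre_digraph.digraph_isomorphism_def)
    have verts: "pverts H = ?f ` pverts G"
      using arg_cong[OF H, of verts] by simp
    \<comment> \<open>Equality of the tail and head fields of the two digraphs forces the
      projections, hence the arc map acts componentwise.\<close>
    have tl: "iso_tail h = fst" and hd: "iso_head h = snd"
      using arg_cong[OF H, of tail] arg_cong[OF H, of head] by simp_all
    have "iso_arcs h e = (?f (fst e), ?f (snd e))" if "e \<in> parcs G" for e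
      using iso that tl hd
      by (auto simp: pre_digraph.digraph_isomorphism_def prod_eq_iff)
    then have arcs: "parcs H = (\<lambda>e. (?f (fst e), ?f (snd e))) ` parcs G"
      using arg_cong[OF H, of arcs] by simp
    have arc_iff: "(?f x, ?f y) \<in> parcs H \<longleftrightarrow> (x, y) \<in> parcs G"
      if "x \<in> pverts G" "y \<in> pverts G" for x y
    proof
      assume "(?f x, ?f y) \<in> parcs H"
      then obtain x' y' where "(x', y') \<in> parcs G" "?f x = ?f x'" "?f y = ?f y'"
        by (auto simp: arcs)
      with that show "(x, y) \<in> parcs G"
        using inj_onD[OF inj] G.in_arcsD1 G.in_arcsD2 by metis
    qed (auto simp: arcs image_iff intro!: bexI[of _ "(x, y)"])
    let ?g = "the_inv_into (pverts G) ?f"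
    have "bij_betw ?g (pverts H) (pverts G)"
      using inj verts by (intro bij_betw_the_inv_into) (simp add: bij_betw_def)
    moreover have "(i, j) \<in> parcs H \<longleftrightarrow> (?g i, ?g j) \<in> parcs G"
      if "i \<in> pverts H" "j \<in> pverts H" for i j
      using that arc_iff by (auto simp: verts the_inv_into_f_f[OF inj])
    ultimately show ?R by blast
  next
    assume ?R
    then obtain g where bij: "bij_betw g (pverts H) (pverts G)"
      and g: "\<And>i j. i \<in> pverts H \<Longrightarrow> j \<in> pverts H \<Longrightarrow> (i, j) \<in> parcs H \<longleftrightarrow> (g i, g j) \<in> parcs G"
      by blast
    let ?f = "the_inv_into (pverts H) g"
    have inj_g: "inj_on g (pverts H)" and img: "g ` pverts H = pverts G"
      using bij by (auto simp: bij_betw_def)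
    have bij_f: "bij_betw ?f (pverts G) (pverts H)"
      using bij by (rule bij_betw_the_inv_into)
    have gf: "g (?f x) = x" and f_in: "?f x \<in> pverts H" if "x \<in> pverts G" for x
      using that inj_g img bij_f by (auto simp: f_the_inv_into_f bij_betw_apply)
    have fg: "?f (g i) = i" if "i \<in> pverts H" for i
      using that inj_g by (simp add: the_inv_into_f_f)
    \<comment> \<open>The tail and head maps are again the projections, so that
      \<open>app_iso h\<close> returns literally \<open>with_proj H\<close>.\<close>
    define h where "h = \<lparr> iso_verts = ?f, iso_arcs = map_prod ?f ?f, iso_head = snd, iso_tail = fst \<rparr>"
    have "inj_on (map_prod ?f ?f) (parcs G)"
    proof (rule inj_on_subset)
      show "inj_on (map_prod ?f ?f) (pverts G \<times> pverts G)"
        using bij_f by (intro map_prod_inj_on) (auto simp: bij_betw_def)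
    qed (auto dest: G.in_arcsD1 G.in_arcsD2)
    then have "pre_digraph.digraph_isomorphism (with_proj G) h"
      using bij_f G.wf_digraph_axioms
      by (auto simp: pre_digraph.digraph_isomorphism_def h_def bij_betw_def)
    moreover have "parcs H = map_prod ?f ?f ` parcs G"
    proof (intro equalityI subsetI)
      fix e assume e: "e \<in> parcs H"
      obtain i j where ij: "e = (i, j)" by fastforce
      with e have "i \<in> pverts H" "j \<in> pverts H"
        by (auto dest: H.in_arcsD1 H.in_arcsD2)
      with e ij show "e \<in> map_prod ?f ?f ` parcs G"
        using g fg by (auto simp: image_iff intro!: bexI[of _ "(g i, g j)"])
    next
      fix e assume "e \<in> map_prod ?f ?f ` parcs G"
      then obtain x y where "e = (?f x, ?f y)" "(x, y) \<in> parcs G" by auto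
      moreover from this have "x \<in> pverts G" "y \<in> pverts G"
        by (auto dest: G.in_arcsD1 G.in_arcsD2)
      ultimately show "e \<in> parcs H"
        using g gf f_in by simp
    qed
    then have "with_proj H = app_iso h (with_proj G)"
      using bij_f by (simp add: with_proj_def app_iso_def h_def bij_betw_def)
    ultimately show ?L
      unfolding digraph_iso_def by blast
  }
qed

text \<open>The nine excluded pairs are the chords, one orientation each. In a symmetric graph this
  makes the six vertices induce a C6, with its cyclic order recorded by the arguments.\<close>

definition hexagon :: "'a pair_pre_digraph \<Rightarrow> 'a \<Rightarrow> 'a \<Rightarrow> 'a \<Rightarrow> 'a \<Rightarrow> 'a \<Rightarrow> 'a \<Rightarrow> bool" where
  "hexagon G a b c d e f \<longleftrightarrow> distinct [a, b, c, d, e, f] \<and>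
    {(a, b), (b, c), (c, d), (d, e), (e, f), (f, a)} \<subseteq> parcs G \<and>
    parcs G \<inter> {(a, c), (a, d), (a, e), (b, d), (b, e), (b, f), (c, e), (c, f), (d, f)} = {}"

lemma pair_wf_digraph_cycle6: "pair_wf_digraph cycle6"
  by unfold_locales (auto simp: cycle6_def)

lemma pair_wf_digraph_triangle_book: "pair_wf_digraph (triangle_book n)"
  by unfold_locales (auto simp: triangle_book_def)

lemma lessThan_6: "{..<6::nat} = {0, 1, 2, 3, 4, 5}"
  by auto

context pair_graph
begin

lemma adj_sym: "(x, y) \<in> parcs G \<Longrightarrow> (y, x) \<in> parcs G"
  using graph_symmetric[of x y] by simp

lemma not_adj_self: "(x, x) \<notin> parcs G"
  using pair_no_loops[of "(x, x)"] by auto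

lemma finite_nbhd: "finite (nbhd G x)"
  by (rule finite_subset[OF _ pair_finite_verts]) (auto simp: nbhd_def dest: in_arcsD2)

lemma uedges_iff: "{x, y} \<in> uedges G \<longleftrightarrow> (x, y) \<in> parcs G"
  by (auto simp: uedges_def doubleton_eq_iff dest: adj_sym)

text \<open>Since \<open>G\<close> is symmetric, connectedness gives a directed path from
  \<open>x\<close> to every vertex, and induction along it stays in \<open>C\<close>. It serves to
  show that a locally determined piece is the whole graph.\<close>

lemma connected_closed_eq:
  assumes "connected (with_proj G)" and "x \<in> C" and "C \<subseteq> pverts G"
    and closed: "\<And>y z. y \<in> C \<Longrightarrow> (y, z) \<in> parcs G \<Longrightarrow> z \<in> C"
  shows "pverts G = C"
proof
  show "pverts G \<subseteq> C"
  proof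
    fix y assume "y \<in> pverts G"
    then have "x \<rightarrow>\<^sup>*\<^bsub>with_proj (mk_symmetric (with_proj G))\<^esub> y"
      using assms(1-3) by (auto simp: connected_def strongly_connected_def)
    then have "x \<rightarrow>\<^sup>*\<^bsub>with_proj G\<^esub> y"
      using reachable_mk_symmetric_eq[OF sym_arcs] by simp
    then have "(x, y) \<in> rtrancl_on (pverts G) (parcs G)"
      by (simp add: reachable_def)
    then show "y \<in> C"
      by (induct rule: rtrancl_on_induct) (use assms(2) closed in blast)+
  qed
qed fact

lemma hexagon_rotate: "hexagon G a b c d e f \<Longrightarrow> hexagon G b c d e f a"
  by (auto simp: hexagon_def dest: adj_sym)

lemma hexagon_reflect: "hexagon G a b c d e f \<Longrightarrow> hexagon G a f e d c b"
  by (auto simp: hexagon_def dest: adj_sym)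

lemma hexagon_verts: "hexagon G a b c d e f \<Longrightarrow> {a, b, c, d, e, f} \<subseteq> pverts G"
  by (auto simp: hexagon_def dest: in_arcsD1)

lemma is_C6_iff_hexagon:
  "is_C6 G \<longleftrightarrow> (\<exists>a b c d e f. hexagon G a b c d e f \<and> pverts G = {a, b, c, d, e, f})"
    (is "_ \<longleftrightarrow> ?R")
proof -
  have "is_C6 G \<longleftrightarrow> (\<exists>g. bij_betw g {..<6} (pverts G) \<and>
      (\<forall>i < 6. \<forall>j < 6. (i, j) \<in> parcs cycle6 \<longleftrightarrow> (g i, g j) \<in> parcs G))" (is "_ \<longleftrightarrow> ?I")
    unfolding is_C6_def
    using digraph_iso_with_proj_iff[OF pair_wf_digraph_axioms pair_wf_digraph_cycle6]
    by (simp add: cycle6_def Ball_def)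
  also have "\<dots> \<longleftrightarrow> ?R"
  proof
    assume ?I
    then obtain g where bij: "bij_betw g {..<6::nat} (pverts G)"
      and g: "\<And>i j. i < 6 \<Longrightarrow> j < 6 \<Longrightarrow> (g i, g j) \<in> parcs G \<longleftrightarrow> (i, j) \<in> parcs cycle6"
      by blast
    have "pverts G = {g 0, g 1, g 2, g 3, g 4, g 5}"
      using bij by (simp add: bij_betw_def lessThan_6)
    moreover have "hexagon G (g 0) (g 1) (g 2) (g 3) (g 4) (g 5)"
      using bij unfolding hexagon_def
      by (simp add: g cycle6_def) (simp add: bij_betw_def lessThan_6)
    ultimately show ?R by blast
  next
    assume ?R
    then obtain a b c d e f where hex: "hexagon G a b c d e f"
      and V: "pverts G = {a, b, c, d, e, f}" by blast
    let ?g = "\<lambda>i::nat. [a, b, c, d, e, f] ! i"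
    have "bij_betw ?g {..<6} (pverts G)"
      using hex unfolding V hexagon_def
      by (intro bij_betw_nth) auto
    moreover have "\<forall>i \<in> {..<6}. \<forall>j \<in> {..<6}. (i, j) \<in> parcs cycle6 \<longleftrightarrow> (?g i, ?g j) \<in> parcs G"
      using hex adj_sym not_adj_self unfolding lessThan_6
      by (auto simp: cycle6_def hexagon_def)
    ultimately show ?I by (auto intro!: exI[of _ ?g])
  qed
  finally show ?thesis .
qed

text \<open>A book is recognized without numbering its pages: \<open>uv\<close> is the spine, and a
  page is known from its neighborhood. The condition \<open>pverts G \<noteq> {u, v}\<close> stands
  for n \<ge> 1.\<close>

lemma in_K_family_iff:
  "in_K_family G \<longleftrightarrow> (\<exists>u v. (u, v) \<in> parcs G \<and> pverts G \<noteq> {u, v} \<and>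
    (\<forall>w \<in> pverts G - {u, v}. nbhd G w = {u, v}))" (is "_ \<longleftrightarrow> ?R")
proof -
  have "in_K_family G \<longleftrightarrow> (\<exists>n \<ge> 1::nat. \<exists>g. bij_betw g {..<n + 2} (pverts G) \<and>
      (\<forall>i < n + 2. \<forall>j < n + 2. (i \<noteq> j \<and> (i < 2 \<or> j < 2)) \<longleftrightarrow> (g i, g j) \<in> parcs G))"
      (is "_ \<longleftrightarrow> ?I")
    unfolding in_K_family_def
    using digraph_iso_with_proj_iff[OF pair_wf_digraph_axioms pair_wf_digraph_triangle_book]
    by (simp add: triangle_book_def Ball_def)
  also have "\<dots> \<longleftrightarrow> ?R"
  proof
    assume ?I
    then obtain n :: nat and g where n: "n \<ge> 1" and bij: "bij_betw g {..<n + 2} (pverts G)"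
      and g: "\<And>i j. i < n + 2 \<Longrightarrow> j < n + 2 \<Longrightarrow> (g i, g j) \<in> parcs G \<longleftrightarrow> i \<noteq> j \<and> (i < 2 \<or> j < 2)"
      by blast
    have img: "pverts G = g ` {..<n + 2}" and inj: "inj_on g {..<n + 2}"
      using bij by (auto simp: bij_betw_def)
    have "(g 0, g 1) \<in> parcs G"
      by (subst g) auto
    moreover have "g 2 \<notin> {g 0, g 1}" "g 2 \<in> pverts G"
      using n inj_onD[OF inj, of 2 0] inj_onD[OF inj, of 2 1] by (auto simp: img)
    then have "pverts G \<noteq> {g 0, g 1}" by blast
    moreover have "nbhd G w = {g 0, g 1}" if w: "w \<in> pverts G - {g 0, g 1}" for w
    proof -
      obtain i where i: "w = g i" "i < n + 2" "i \<noteq> 0" "i \<noteq> 1"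
        using w by (auto simp: img)
      show ?thesis
      proof (intro equalityI subsetI)
        fix x assume "x \<in> nbhd G w"
        then have x: "(g i, x) \<in> parcs G" by (simp add: nbhd_def i)
        then obtain j where "x = g j" "j < n + 2"
          using in_arcsD2[OF x] by (auto simp: img)
        with x i g[of i j] have "j = 0 \<or> j = 1" by auto
        then show "x \<in> {g 0, g 1}" using \<open>x = g j\<close> by auto
      next
        fix x assume "x \<in> {g 0, g 1}"
        then show "x \<in> nbhd G w"
          using i g[of i 0] g[of i 1] by (auto simp: nbhd_def)
      qed
    qed
    ultimately show ?R by blast
  next
    assume ?R
    then obtain u v where uv: "(u, v) \<in> parcs G" and ne: "pverts G \<noteq> {u, v}"
      and nb: "\<And>w. w \<in> pverts G - {u, v} \<Longrightarrow> nbhd G w = {u, v}" by blast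
    define W where "W = pverts G - {u, v}"
    have uvV: "u \<in> pverts G" "v \<in> pverts G" "u \<noteq> v"
      using uv in_arcsD1 in_arcsD2 not_adj_self by auto
    have fin: "finite W" and W: "W \<noteq> {}"
      using pair_finite_verts ne uvV by (auto simp: W_def)
    let ?n = "card W"
    obtain h where h: "bij_betw h {..<?n} W"
      using ex_bij_betw_nat_finite[OF fin] by (auto simp: atLeast0LessThan)
    \<comment> \<open>The spine takes the indices 0 and 1, so the enumeration \<open>h\<close> of
      the pages is shifted by two.\<close>
    define g where "g i = (if i = 0 then u else if i = 1 then v else h (i - 2))" for i
    have h_in: "h i \<in> W" if "i < ?n" for i
      using h that by (auto simp: bij_betw_def)
    have inj: "inj_on g {..<?n + 2}"
    proof (rule inj_onI)
      fix i j assume ij: "i \<in> {..<?n + 2}" "j \<in> {..<?n + 2}" "g i = g j"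
      have "i \<ge> 2 \<Longrightarrow> h (i - 2) \<in> W" "j \<ge> 2 \<Longrightarrow> h (j - 2) \<in> W"
        using ij by (auto intro!: h_in)
      moreover have "i \<ge> 2 \<Longrightarrow> j \<ge> 2 \<Longrightarrow> h (i - 2) = h (j - 2) \<Longrightarrow> i - 2 = j - 2"
        using h ij by (auto simp: bij_betw_def dest!: inj_onD)
      ultimately show "i = j"
        using ij(3) uvV by (auto simp: g_def W_def not_less_eq_eq split: if_splits)
    qed
    have sub: "g ` {..<?n + 2} \<subseteq> pverts G"
    proof
      fix x assume "x \<in> g ` {..<?n + 2}"
      then obtain i where i: "i < ?n + 2" "x = g i" by auto
      have "i \<ge> 2 \<Longrightarrow> h (i - 2) \<in> W"
        using i by (auto intro!: h_in)
      then show "x \<in> pverts G"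
        using i uvV by (auto simp: g_def W_def not_less_eq_eq)
    qed
    have "card (pverts G) = ?n + 2"
      using uvV pair_finite_verts card_Diff_subset[of "{u, v}" "pverts G"] card_mono[of "pverts G" "{u, v}"]
      by (auto simp: W_def)
    then have img: "g ` {..<?n + 2} = pverts G"
      using card_subset_eq[OF pair_finite_verts sub] card_image[OF inj] by simp
    have "(g i, g j) \<in> parcs G \<longleftrightarrow> i \<noteq> j \<and> (i < 2 \<or> j < 2)" if ij: "i < ?n + 2" "j < ?n + 2" for i j
    proof -
      have cases: "g k = u \<and> k = 0 \<or> g k = v \<and> k = 1 \<or> k \<ge> 2 \<and> nbhd G (g k) = {u, v} \<and> g k \<notin> {u, v}" if "k < ?n + 2" for k
      proof (cases "k \<ge> 2")
        case True
        then have "g k \<in> W"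
          using that by (auto simp: g_def intro!: h_in)
        then show ?thesis using True nb by (auto simp: W_def)
      qed (auto simp: g_def)
      show ?thesis
        using cases[OF ij(1)] cases[OF ij(2)] uv adj_sym not_adj_self
        by (auto simp: nbhd_def set_eq_iff)
    qed
    moreover have "?n \<ge> 1"
      using fin W by (simp add: Suc_le_eq card_gt_0_iff)
    ultimately show ?I
      using inj img by (auto simp: bij_betw_def intro!: exI[of _ ?n] exI[of _ g])
  qed
  finally show ?thesis .
qed

section \<open>Induced hexagons and the edges in \<open>M_edges G\<close>\<close>

lemma induced_pair_graph:
  assumes "induced_subgraph (with_proj H) (with_proj G)"
  shows "pair_graph H"
    and "pverts H \<subseteq> pverts G"
    and "parcs H = parcs G \<inter> pverts H \<times> pverts H"
proof -
  show V: "pverts H \<subseteq> pverts G"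
    and A: "parcs H = parcs G \<inter> pverts H \<times> pverts H"
    using assms by (auto simp: induced_subgraph_def subgraph_def)
  have "sym (parcs H)"
    using A adj_sym by (auto simp: sym_def)
  then show "pair_graph H"
    using A V not_adj_self finite_subset[OF V pair_finite_verts] pair_finite_arcs
    by unfold_locales (auto simp: symmetric_def)
qed

lemma hexagon_induced:
  assumes "parcs H = parcs G \<inter> pverts H \<times> pverts H" and "{a, b, c, d, e, f} \<subseteq> pverts H"
  shows "hexagon H a b c d e f \<longleftrightarrow> hexagon G a b c d e f"
  using assms by (auto simp: hexagon_def)

lemma hexagon_nbhd_within:
  assumes "hexagon G a b c d e f" and "pverts G = {a, b, c, d, e, f}"
  shows "nbhd G a = {b, f}"
  using assms adj_sym in_arcsD2 not_adj_self by (fastforce simp: nbhd_def hexagon_def)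

text \<open>By the dihedral symmetry of C6 the labelling can be rotated until \<open>u\<close> comes
  first and reflected until \<open>v\<close> comes second; then \<open>x\<close> and
  \<open>y\<close> are the only remaining neighbors of \<open>u\<close> and
  \<open>v\<close>.\<close>

lemma C6_hexagon_path:
  assumes C6: "is_C6 G" and xu: "(x, u) \<in> parcs G" and uv: "(u, v) \<in> parcs G"
    and vy: "(v, y) \<in> parcs G" and "x \<noteq> v" "y \<noteq> u"
  shows "\<exists>d e. hexagon G x u v y d e \<and> pverts G = {x, u, v, y, d, e}"
proof -
  define P where "P a b c d e f \<longleftrightarrow> hexagon G a b c d e f \<and> pverts G = {a, b, c, d, e, f}"
    for a b c d e f
  have rot: "P b c d e f a" if "P a b c d e f" for a b c d e f
  proof -
    have "{a, b, c, d, e, f} = {b, c, d, e, f, a}" by blast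
    with that show ?thesis
      unfolding P_def by (metis hexagon_rotate)
  qed
  have refl: "P a f e d c b" if "P a b c d e f" for a b c d e f
  proof -
    have "{a, b, c, d, e, f} = {a, f, e, d, c, b}" by blast
    with that show ?thesis
      unfolding P_def by (metis hexagon_reflect)
  qed
  have nb: "y = b \<or> y = f" if "P a b c d e f" "(a, y) \<in> parcs G" for a b c d e f y
    using hexagon_nbhd_within[of a b c d e f] that by (auto simp: P_def nbhd_def)
  obtain a b c d e f where P: "P a b c d e f"
    using C6 by (auto simp: is_C6_iff_hexagon P_def)
  have "u \<in> {a, b, c, d, e, f}"
    using in_arcsD1[OF uv] P by (simp add: P_def)
  then have "\<exists>b c d e f. P u b c d e f"
    using P P[THEN rot] P[THEN rot, THEN rot] P[THEN rot, THEN rot, THEN rot]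
      P[THEN rot, THEN rot, THEN rot, THEN rot] P[THEN rot, THEN rot, THEN rot, THEN rot, THEN rot]
    by (elim insertE emptyE) blast+
  then obtain b c d e f where P: "P u b c d e f"
    by blast
  have "v = b \<or> v = f"
    using nb[OF P uv] .
  then have "\<exists>c d e f. P u v c d e f"
    using P refl[OF P] by blast
  then obtain c d e f where P: "P u v c d e f"
    by blast
  have "x = f"
    using nb[OF P adj_sym[OF xu]] \<open>x \<noteq> v\<close> by blast
  moreover have "y = c"
    using nb[OF P[THEN rot] vy] \<open>y \<noteq> u\<close> by blast
  ultimately show ?thesis
    using P[THEN rot, THEN rot, THEN rot, THEN rot, THEN rot] unfolding P_def by blast
qed

text \<open>Adjacency and non-adjacency among the six vertices are the same in \<open>G\<close> and
  in an induced subgraph, so the quantifier over \<open>H\<close> can be traded for a labelled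
  hexagon in \<open>G\<close> itself.\<close>

lemma M_edges_iff_hexagon:
  "E \<in> M_edges G \<longleftrightarrow> (\<exists>x u v y d e. hexagon G x u v y d e \<and> x \<in> d2 G \<and> y \<in> d2 G \<and> E = {u, v})"
proof
  assume "E \<in> M_edges G"
  then obtain u v x y H where E: "E = {u, v}" and d2: "x \<in> d2 G" "y \<in> d2 G" "x \<noteq> v" "y \<noteq> u"
    and ind: "induced_subgraph (with_proj H) (with_proj G)" and C6: "is_C6 H"
    and edges: "{{x, u}, {u, v}, {v, y}} \<subseteq> uedges H"
    unfolding M_edges_def mem_Collect_eq
    by (elim exE conjE bexE IntE) (rule that, assumption+)
  note H = induced_pair_graph[OF ind]
  interpret H: pair_graph H by (rule H(1))
  obtain d e where hex: "hexagon H x u v y d e"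
    using H.C6_hexagon_path[OF C6, of x u v y] edges d2 by (auto simp: H.uedges_iff)
  then have "hexagon G x u v y d e"
    using hexagon_induced[OF H(3) H.hexagon_verts[OF hex]] by simp
  with E d2 show "\<exists>x u v y d e. hexagon G x u v y d e \<and> x \<in> d2 G \<and> y \<in> d2 G \<and> E = {u, v}"
    by blast
next
  assume "\<exists>x u v y d e. hexagon G x u v y d e \<and> x \<in> d2 G \<and> y \<in> d2 G \<and> E = {u, v}"
  then obtain x u v y d e where hex: "hexagon G x u v y d e" and d2: "x \<in> d2 G" "y \<in> d2 G"
    and E: "E = {u, v}" by blast
  define C where "C = {x, u, v, y, d, e}"
  have C: "C \<subseteq> pverts G"
    using hexagon_verts[OF hex] by (simp add: C_def)
  define H where "H = \<lparr> pverts = C, parcs = parcs G \<inter> C \<times> C \<rparr>"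
  have H: "pverts H = C" "parcs H = parcs G \<inter> pverts H \<times> pverts H"
    by (simp_all add: H_def)
  have "pair_wf_digraph H"
    by unfold_locales (auto simp: H_def)
  then have ind: "induced_subgraph (with_proj H) (with_proj G)"
    using C wf_digraph_axioms wf_digraph_wp_iff[of H]
    by (auto simp: induced_subgraph_def subgraph_def H_def)
  interpret H: pair_graph H
    by (rule induced_pair_graph[OF ind])
  have hexH: "hexagon H x u v y d e"
    using hexagon_induced[OF H(2)] hex by (simp add: H(1) C_def)
  then have "is_C6 H"
    unfolding H.is_C6_iff_hexagon H(1) C_def by blast
  moreover have "{{x, u}, {u, v}, {v, y}} \<subseteq> uedges H"
    using hexH by (simp add: H.uedges_iff hexagon_def)
  moreover have "{u, v} \<in> uedges G" "x \<in> nbhd G u" "y \<in> nbhd G v" "x \<noteq> v" "y \<noteq> u"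
    using hex by (auto simp: hexagon_def uedges_iff nbhd_def intro: adj_sym)
  ultimately show "E \<in> M_edges G"
    unfolding M_edges_def E mem_Collect_eq using d2 ind
    by (intro exI[of _ u] exI[of _ v] bexI[of _ x] bexI[of _ y] exI[of _ H] conjI IntI refl)
qed

end

subsection \<open>Tight matchings\<close>

definition tight_matching :: "'a pair_pre_digraph \<Rightarrow> 'a set set \<Rightarrow> bool" where
  "tight_matching G M \<longleftrightarrow> maximal_matching G M \<and>
    (\<forall>v \<in> matching_verts M. nbhd G v \<inter> matching_verts M = {partner M v}) \<and>
    (\<forall>u \<in> matching_verts M. \<forall>v \<in> matching_verts M.
      u \<noteq> v \<longrightarrow> nbhd G u \<inter> nbhd G v \<noteq> {} \<longrightarrow>
      (\<exists>w \<in> pverts G. nbhd G w = {partner M u, partner M v}))"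

context pair_graph
begin

text \<open>Two matching edges through \<open>x\<close> meet and therefore coincide, so the definite
  description in \<open>partner\<close> is well defined.\<close>

lemma matching_partner_eq:
  assumes "matching G M" and "{x, y} \<in> M"
  shows "partner M x = y"
  unfolding partner_def
proof (rule the_equality)
  fix z assume "{x, z} \<in> M"
  moreover have "\<not> disjnt {x, z} {x, y}" by simp
  ultimately have "{x, z} = {x, y}"
    using assms pairwiseD unfolding matching_def by metis
  then show "z = y" by (auto simp: doubleton_eq_iff)
qed fact

lemma matching_partner:
  assumes M: "matching G M" and x: "x \<in> matching_verts M"
  shows "{x, partner M x} \<in> M" "(x, partner M x) \<in> parcs G"
    "partner M x \<in> matching_verts M" "partner M (partner M x) = x"
proof -
  obtain e where e: "e \<in> M" "x \<in> e"
    using x by (auto simp: matching_verts_def)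
  then have "e \<in> uedges G"
    using M by (auto simp: matching_def)
  with e obtain y where xy: "{x, y} \<in> M" "(x, y) \<in> parcs G"
    by (auto simp: uedges_def doubleton_eq_iff insert_commute dest: adj_sym)
  then show "{x, partner M x} \<in> M" "(x, partner M x) \<in> parcs G"
    using matching_partner_eq[OF M] by auto
  then show "partner M x \<in> matching_verts M" "partner M (partner M x) = x"
    using matching_partner_eq[OF M, of "partner M x" x]
    by (auto simp: matching_verts_def insert_commute)
qed

lemma matching_verts_subset: "matching G M \<Longrightarrow> matching_verts M \<subseteq> pverts G"
  using matching_partner(2) in_arcsD1 by blast

lemma finite_matching_verts: "matching G M \<Longrightarrow> finite (matching_verts M)"
  using finite_subset[OF matching_verts_subset pair_finite_verts] .

lemma card_matching_verts:
  assumes "matching G M"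
  shows "card (matching_verts M) = 2 * card M"
proof -
  have "card e = 2" if "e \<in> M" for e
  proof -
    have "e \<in> uedges G"
      using that assms by (auto simp: matching_def)
    then show ?thesis
      using not_adj_self by (auto simp: uedges_def card_insert_if)
  qed
  moreover from this have "finite e" if "e \<in> M" for e
    using that by (metis card.infinite zero_neq_numeral)
  ultimately show ?thesis
    using assms card_Union_disjoint[of M]
    by (simp add: matching_verts_def matching_def)
qed

text \<open>An edge with both ends unmatched could be added to \<open>M\<close>; conversely, if
  every edge has a matched end, any edge added to \<open>M\<close> meets an edge of
  \<open>M\<close>.\<close>

lemma maximal_matching_iff_cover:
  "maximal_matching G M \<longleftrightarrow> matching G M \<and>
    (\<forall>x y. (x, y) \<in> parcs G \<longrightarrow> x \<in> matching_verts M \<or> y \<in> matching_verts M)"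
proof (intro iffI conjI allI impI)
  assume max: "maximal_matching G M"
  then show M: "matching G M" by (simp add: maximal_matching_def)
  fix x y assume xy: "(x, y) \<in> parcs G"
  show "x \<in> matching_verts M \<or> y \<in> matching_verts M"
  proof (rule ccontr)
    assume out: "\<not> ?thesis"
    then have "matching G (insert {x, y} M)"
      using M xy uedges_iff
      by (auto simp: matching_def matching_verts_def pairwise_insert disjnt_def)
    moreover have "{x, y} \<notin> M"
      using out by (auto simp: matching_verts_def)
    ultimately show False
      using max by (auto simp: maximal_matching_def)
  qed
next
  assume M: "matching G M \<and>
    (\<forall>x y. (x, y) \<in> parcs G \<longrightarrow> x \<in> matching_verts M \<or> y \<in> matching_verts M)"
  have False if M': "matching G M'" "M \<subset> M'" for M'
  proof -
    obtain e where e: "e \<in> M'" "e \<notin> M" using M' by blast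
    then have "e \<in> uedges G"
      using M' by (auto simp: matching_def)
    then obtain x y where xy: "e = {x, y}" "(x, y) \<in> parcs G"
      by (auto simp: uedges_def)
    then obtain f where f: "f \<in> M" "e \<inter> f \<noteq> {}"
      using M by (auto simp: matching_verts_def)
    moreover have "f \<in> M'" "e \<noteq> f"
      using f e M' by auto
    ultimately show False
      using e M' pairwiseD[of disjnt M' e f] by (auto simp: matching_def disjnt_def)
  qed
  with M show "maximal_matching G M"
    by (auto simp: maximal_matching_def)
qed

section \<open>Finiteness and attainment of the two minima\<close>

lemma finite_matchings: "finite {M. matching G M}"
proof (rule finite_subset)
  show "{M. matching G M} \<subseteq> Pow (Pow (pverts G))"
    by (auto simp: matching_def uedges_def dest: in_arcsD1 in_arcsD2)
qed (use pair_finite_verts in simp)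

lemma ex_maximal_matching: "\<exists>M. maximal_matching G M"
proof -
  have "{} \<in> {M. matching G M}" by (simp add: matching_def)
  then obtain M where M: "M \<in> {M. matching G M}"
      and max: "\<And>M'. M' \<in> {M. matching G M} \<Longrightarrow> M \<subseteq> M' \<Longrightarrow> M = M'"
    using finite_has_maximal[OF finite_matchings] by blast
  then show ?thesis by (auto simp: maximal_matching_def)
qed

lemma finite_maximal_matchings: "finite {M. maximal_matching G M}"
  by (rule finite_subset[OF _ finite_matchings]) (auto simp: maximal_matching_def)

lemma finite_total_dominating: "finite {S. total_dominating G S}"
  by (rule finite_subset[of _ "Pow (pverts G)"])
    (use pair_finite_verts in \<open>auto simp: total_dominating_def\<close>)

lemma min_maximal_matching_le: "maximal_matching G M \<Longrightarrow> min_maximal_matching_number G \<le> card M"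
  unfolding min_maximal_matching_number_def using finite_maximal_matchings by (intro Min_le) auto

lemma min_maximal_matching_attained:
  obtains M where "maximal_matching G M" "card M = min_maximal_matching_number G"
proof -
  have "min_maximal_matching_number G \<in> card ` {M. maximal_matching G M}"
    unfolding min_maximal_matching_number_def
    using finite_maximal_matchings ex_maximal_matching by (intro Min_in) auto
  then show ?thesis using that by auto
qed

lemma total_domination_le: "total_dominating G S \<Longrightarrow> total_domination_number G \<le> card S"
  unfolding total_domination_number_def using finite_total_dominating by (intro Min_le) auto

lemma total_domination_attained:
  assumes "total_dominating G S"
  obtains D where "total_dominating G D" "card D = total_domination_number G"
proof -
  have "total_domination_number G \<in> card ` {S. total_dominating G S}"
    unfolding total_domination_number_def
    using finite_total_dominating assms by (intro Min_in) auto
  then show ?thesis using that by auto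
qed

lemma tight_matchingD:
  assumes "tight_matching G M"
  shows "matching G M"
    and "\<And>x y. (x, y) \<in> parcs G \<Longrightarrow> x \<in> matching_verts M \<or> y \<in> matching_verts M"
    and "\<And>x y. x \<in> matching_verts M \<Longrightarrow> y \<in> matching_verts M \<Longrightarrow> (x, y) \<in> parcs G \<Longrightarrow> partner M x = y"
    and "\<And>x y w. x \<in> matching_verts M \<Longrightarrow> y \<in> matching_verts M \<Longrightarrow> x \<noteq> y \<Longrightarrow>
      (x, w) \<in> parcs G \<Longrightarrow> (y, w) \<in> parcs G \<Longrightarrow>
      \<exists>z \<in> pverts G. nbhd G z = {partner M x, partner M y}"
proof -
  have *: "maximal_matching G M"
    "\<And>v. v \<in> matching_verts M \<Longrightarrow> nbhd G v \<inter> matching_verts M = {partner M v}"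
    "\<And>u v. u \<in> matching_verts M \<Longrightarrow> v \<in> matching_verts M \<Longrightarrow> u \<noteq> v \<Longrightarrow>
      nbhd G u \<inter> nbhd G v \<noteq> {} \<Longrightarrow> \<exists>w \<in> pverts G. nbhd G w = {partner M u, partner M v}"
    using assms unfolding tight_matching_def by blast+
  then show "matching G M"
    and "\<And>x y. (x, y) \<in> parcs G \<Longrightarrow> x \<in> matching_verts M \<or> y \<in> matching_verts M"
    by (auto simp: maximal_matching_iff_cover)
  show "partner M x = y" if "x \<in> matching_verts M" "y \<in> matching_verts M" "(x, y) \<in> parcs G" for x y
  proof -
    have "y \<in> nbhd G x \<inter> matching_verts M"
      using that by (simp add: nbhd_def)
    then show ?thesis
      unfolding *(2)[OF that(1)] by simp
  qed
  show "\<exists>z \<in> pverts G. nbhd G z = {partner M x, partner M y}"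
    if "x \<in> matching_verts M" "y \<in> matching_verts M" "x \<noteq> y" "(x, w) \<in> parcs G" "(y, w) \<in> parcs G"
    for x y w
    using *(3)[OF that(1-3)] that(4,5) by (auto simp: nbhd_def)
qed

section \<open>A tight matching bounds total dominating sets from below\<close>

lemma tight_matching_card_le:
  assumes M: "tight_matching G M" and D: "total_dominating G D"
  shows "card (matching_verts M) \<le> card D"
proof -
  note tight = tight_matchingD[OF M] and mate = matching_partner[OF tight_matchingD(1)[OF M]]
  let ?S = "matching_verts M"
  have "\<exists>d \<in> D. (x, d) \<in> parcs G" if "x \<in> pverts G" for x
    using D that by (auto simp: total_dominating_def)
  then obtain g where g: "\<And>x. x \<in> pverts G \<Longrightarrow> g x \<in> D" "\<And>x. x \<in> pverts G \<Longrightarrow> (x, g x) \<in> parcs G"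
    by metis
  have S: "\<And>x. x \<in> ?S \<Longrightarrow> x \<in> pverts G"
    using matching_verts_subset[OF tight(1)] by blast
  define h where "h x = (if partner M x \<in> D then partner M x else g x)" for x
  \<comment> \<open>By (i) the partner is the only neighbor of \<open>x\<close> in V(M). Hence the
    two branches of \<open>h\<close> take values inside and outside V(M), which settles the mixed
    cases below.\<close>
  have outside: "g x \<notin> ?S" if "x \<in> ?S" "partner M x \<notin> D" for x
    using tight(3)[OF that(1) _ g(2)[OF S[OF that(1)]]] g(1)[OF S[OF that(1)]] that(2) by auto
  have "inj_on h ?S"
  proof (rule inj_onI)
    fix x y assume x: "x \<in> ?S" and y: "y \<in> ?S" and eq: "h x = h y"
    consider "partner M x \<in> D" "partner M y \<in> D" | "partner M x \<in> D" "partner M y \<notin> D"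
      | "partner M x \<notin> D" "partner M y \<in> D" | "partner M x \<notin> D" "partner M y \<notin> D"
      by blast
    then show "x = y"
    proof cases
      case 1
      then show ?thesis using eq mate(4) x y by (metis h_def)
    next
      case 2
      then show ?thesis using eq mate(3)[OF x] outside[OF y] by (simp add: h_def)
    next
      case 3
      then show ?thesis using eq mate(3)[OF y] outside[OF x] by (simp add: h_def)
    next
      case 4
      show ?thesis
      proof (rule ccontr)
        assume "x \<noteq> y"
        \<comment> \<open>The common dominator \<open>g x\<close> is a shared neighbor, so (ii)
          yields a vertex whose only neighbors are two partners missing from \<open>D\<close>: it is
          not dominated.\<close>
        then obtain z where z: "z \<in> pverts G" "nbhd G z = {partner M x, partner M y}"
          using tight(4)[OF x y, of "g x"] g(2)[OF S[OF x]] g(2)[OF S[OF y]] eq 4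
          by (auto simp: h_def)
        have "g z \<in> nbhd G z" using g(2)[OF z(1)] by (simp add: nbhd_def)
        with z 4 g(1)[OF z(1)] show False by auto
      qed
    qed
  qed
  moreover have "h ` ?S \<subseteq> D"
    using g S by (auto simp: h_def)
  moreover have "finite D"
    using D pair_finite_verts by (auto simp: total_dominating_def intro: finite_subset)
  ultimately show ?thesis
    by (rule card_inj_on_le)
qed

end

section \<open>Minimum degree two: equality in terms of tight matchings\<close>

locale min_degree_two_graph = pair_graph G for G :: "'a pair_pre_digraph" +
  assumes two_le_degree: "v \<in> pverts G \<Longrightarrow> 2 \<le> Defs.degree G v"
begin

lemma nbhd_eqI:
  assumes "x \<in> pverts G" and sub: "nbhd G x \<subseteq> {y, z}"
  shows "nbhd G x = {y, z}"
proof (rule card_seteq)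
  have "card {y, z} \<le> 2" by (simp add: card_insert_if)
  then show "card {y, z} \<le> card (nbhd G x)"
    using two_le_degree[OF assms(1)] by (simp add: Defs.degree_def)
qed (use sub in simp_all)

lemma ex_other_nbr:
  assumes "x \<in> pverts G"
  shows "\<exists>z. (x, z) \<in> parcs G \<and> z \<noteq> y"
proof (rule ccontr)
  assume "\<not> ?thesis"
  then have "nbhd G x \<subseteq> {y}" by (auto simp: nbhd_def)
  then have "card (nbhd G x) \<le> 1"
    using card_mono[of "{y}" "nbhd G x"] by simp
  then show False
    using two_le_degree[OF assms] by (simp add: Defs.degree_def)
qed

text \<open>A matched vertex is dominated by its partner; an unmatched one has a neighbor, which is
  matched because the matching is maximal.\<close>

lemma total_dominating_matching_verts:
  assumes "maximal_matching G M"
  shows "total_dominating G (matching_verts M)"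
proof -
  have M: "matching G M"
    and cover: "\<And>x y. (x, y) \<in> parcs G \<Longrightarrow> x \<in> matching_verts M \<or> y \<in> matching_verts M"
    using assms by (auto simp: maximal_matching_iff_cover)
  have "\<exists>y \<in> matching_verts M. (x, y) \<in> parcs G" if "x \<in> pverts G" for x
    using matching_partner[OF M, of x] ex_other_nbr[OF that] cover by blast
  then show ?thesis
    using matching_verts_subset[OF M] by (auto simp: total_dominating_def)
qed

lemma tight_matchingI_minimum:
  assumes max: "maximal_matching G M"
    and le: "\<And>D. total_dominating G D \<Longrightarrow> card (matching_verts M) \<le> card D"
  shows "tight_matching G M"
proof -
  let ?S = "matching_verts M" and ?p = "partner M"
  have M: "matching G M"
    and cover: "\<And>x y. (x, y) \<in> parcs G \<Longrightarrow> x \<in> ?S \<or> y \<in> ?S"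
    using max by (auto simp: maximal_matching_iff_cover)
  note mate = matching_partner[OF M]
  note fin = finite_matching_verts[OF M]
  have S: "?S \<subseteq> pverts G" by (rule matching_verts_subset[OF M])
  have "nbhd G v \<inter> ?S = {?p v}" if v: "v \<in> ?S" for v
  proof (rule ccontr)
    assume "\<not> ?thesis"
    then obtain q where q: "q \<in> ?S" "(v, q) \<in> parcs G" "q \<noteq> ?p v"
      using mate(2,3)[OF v] by (auto simp: nbhd_def)
    \<comment> \<open>After deleting \<open>?p v\<close>, the vertex \<open>v\<close> is dominated
      by \<open>q\<close>, other matched vertices by their own partners, and an unmatched vertex by
      a second neighbor, which is matched by maximality.\<close>
    have "\<exists>y \<in> ?S - {?p v}. (x, y) \<in> parcs G" if x: "x \<in> pverts G" for x
    proof (cases "x \<in> ?S")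
      case True
      show ?thesis
      proof (cases "x = v")
        case False
        then have "?p x \<noteq> ?p v" using mate(4) True v by metis
        then show ?thesis using mate(2,3)[OF True] by blast
      qed (use q in blast)
    next
      case False
      then show ?thesis using ex_other_nbr[OF x, of "?p v"] cover by blast
    qed
    then have "total_dominating G (?S - {?p v})"
      using S by (auto simp: total_dominating_def)
    then show False
      using le card_Diff1_less[OF fin mate(3)[OF v]] by fastforce
  qed
  moreover have "\<exists>z \<in> pverts G. nbhd G z = {?p u, ?p v}"
    if uv: "u \<in> ?S" "v \<in> ?S" "u \<noteq> v" and nb: "nbhd G u \<inter> nbhd G v \<noteq> {}" for u v
  proof -
    obtain w where w: "(u, w) \<in> parcs G" "(v, w) \<in> parcs G"
      using nb by (auto simp: nbhd_def)
    have ne: "?p u \<noteq> ?p v" using mate(4) uv by metis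
    \<comment> \<open>Two vertices leave and at most one enters, so \<open>D\<close> is too small to
      be total dominating.\<close>
    define D where "D = insert w (?S - {?p u, ?p v})"
    have "card {?p u, ?p v} \<le> card ?S"
      using fin mate(3) uv by (intro card_mono) auto
    then have "card D < card ?S"
      using fin mate(3) uv ne card_Diff_subset[of "{?p u, ?p v}" ?S]
      by (auto simp: D_def card_insert_if)
    then have "\<not> total_dominating G D"
      using le by fastforce
    moreover have "D \<subseteq> pverts G"
      using S in_arcsD2[OF w(1)] by (auto simp: D_def)
    ultimately obtain z where z: "z \<in> pverts G" and undom: "\<And>y. (z, y) \<in> parcs G \<Longrightarrow> y \<notin> D"
      by (auto simp: total_dominating_def)
    \<comment> \<open>For a matched \<open>z\<close> the partner must be one of the two deleted
      vertices, so \<open>z\<close> is \<open>u\<close> or \<open>v\<close>; but \<open>w\<close>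
      dominates both.\<close>
    have "z \<notin> ?S"
    proof
      assume "z \<in> ?S"
      then have "?p z \<in> {?p u, ?p v}"
        using undom[OF mate(2)] mate(3) by (auto simp: D_def)
      then have "z \<in> {u, v}"
        using mate(4) \<open>z \<in> ?S\<close> uv by (metis insert_iff singletonD)
      then show False
        using undom w by (auto simp: D_def)
    qed
    then have "nbhd G z \<subseteq> {?p u, ?p v}"
      using undom cover by (auto simp: nbhd_def D_def)
    then show ?thesis
      using nbhd_eqI[OF z] z by blast
  qed
  ultimately show ?thesis
    using max by (simp add: tight_matching_def)
qed

text \<open>Let \<open>M\<close> be a smallest maximal matching. Equality makes V(M) a minimum total
  dominating set, so \<open>M\<close> is tight. Conversely, a tight \<open>T\<close> and a minimum
  total dominating set \<open>D\<close> give 2|M| \<le> 2|T| \<le> |D| \<le> |V(M)| = 2|M|.\<close>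

lemma domination_eq_iff_tight_matching:
  "total_domination_number G = 2 * min_maximal_matching_number G \<longleftrightarrow> (\<exists>M. tight_matching G M)"
proof
  obtain M where M: "maximal_matching G M" "card M = min_maximal_matching_number G"
    by (rule min_maximal_matching_attained)
  have card: "card (matching_verts M) = 2 * min_maximal_matching_number G"
    using M card_matching_verts by (simp add: maximal_matching_def)
  {
    assume "total_domination_number G = 2 * min_maximal_matching_number G"
    then show "\<exists>M. tight_matching G M"
      using tight_matchingI_minimum[OF M(1)] total_domination_le card by auto
  next
    assume "\<exists>M. tight_matching G M"
    then obtain T where T: "tight_matching G T" by blast
    have dom: "total_dominating G (matching_verts M)"
      by (rule total_dominating_matching_verts[OF M(1)])
    then obtain D where D: "total_dominating G D" "card D = total_domination_number G"
      by (rule total_domination_attained)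
    have "2 * min_maximal_matching_number G \<le> 2 * card T"
      using min_maximal_matching_le T by (auto simp: tight_matching_def)
    also have "\<dots> \<le> card D"
      using tight_matching_card_le[OF T D(1)] card_matching_verts[OF tight_matchingD(1)[OF T]] by simp
    finally show "total_domination_number G = 2 * min_maximal_matching_number G"
      using total_domination_le[OF dom] card D(2) by simp
  }
qed

subsection \<open>The edge set \<open>\<M>(G)\<close>\<close>

text \<open>If \<open>M\<close> contains \<open>au\<close>, then \<open>V(M)\<close> meets the hexagon exactly in \<open>a, u, b, v'\<close>. Condition (ii),
  applied to pairs of these with a common neighbor, demands vertices with prescribed neighborhoods;
  since \<open>a\<close> and \<open>b\<close> have degree two, only vertices of the hexagon qualify, and so it has no outside
  neighbors.\<close>
lemma tight_hexagon_partner_nbhd: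
  assumes M: "tight_matching G M" and hex: "hexagon G a u v b v' u'"
    and a: "nbhd G a = {u, u'}" "a \<in> matching_verts M" "partner M a = u"
    and b: "nbhd G b = {v, v'}"
  shows "b \<in> matching_verts M" "partner M b = v'" "nbhd G u = {a, v}" "nbhd G v = {u, b}"
proof -
  let ?S = "matching_verts M" and ?p = "partner M"
  note tight = tight_matchingD[OF M] and mate = matching_partner[OF tight_matchingD(1)[OF M]]
  have dist: "distinct [a, u, v, b, v', u']"
    and adj: "(a, u) \<in> parcs G" "(u, v) \<in> parcs G" "(v, b) \<in> parcs G" "(b, v') \<in> parcs G"
      "(v', u') \<in> parcs G" "(u', a) \<in> parcs G"
    and nadj: "(u, v') \<notin> parcs G" "(v', u) \<notin> parcs G"
    using hex by (auto simp: hexagon_def dest: adj_sym)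
  note adj' = adj[THEN adj_sym]
  have u: "u \<in> ?S" "?p u = a"
    using mate a by auto
  have "u' \<notin> ?S"
    using tight(3)[OF a(2) _ adj'(6)] a(3) dist by auto
  then have v': "v' \<in> ?S"
    using tight(2)[OF adj(5)] by blast
  have "v \<notin> ?S"
    using tight(3)[OF u(1) _ adj(2)] u(2) dist by auto
  then show bS: "b \<in> ?S"
    using tight(2)[OF adj(3)] by blast
  then show pb: "?p b = v'"
    using tight(3)[OF _ v' adj(4)] by blast
  then have pv': "?p v' = b"
    using mate(4)[OF bS] by simp
  \<comment> \<open>Condition (ii) for \<open>a\<close> and \<open>v'\<close>, which share
    \<open>u'\<close>. The resulting vertex is a neighbor of \<open>b\<close>, and \<open>v'\<close>
    is excluded since it is not adjacent to \<open>u\<close>, so it is \<open>v\<close>.\<close>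
  obtain z where "nbhd G z = {u, b}"
    using tight(4)[OF a(2) v' _ adj'(6) adj(5)] dist a(3) pv' by auto
  moreover from this have "z \<in> nbhd G b" "(z, u) \<in> parcs G"
    by (auto simp: nbhd_def intro: adj_sym)
  ultimately show Nv: "nbhd G v = {u, b}"
    using b nadj by auto
  obtain z where "nbhd G z = {a, v'}"
    using tight(4)[OF u(1) bS _ adj(2) adj'(3)] dist u(2) pb by auto
  moreover from this have "z \<in> nbhd G a" "(z, v') \<in> parcs G"
    by (auto simp: nbhd_def intro: adj_sym)
  ultimately have Nu': "nbhd G u' = {a, v'}"
    using a(1) nadj by auto
  \<comment> \<open>A further neighbor \<open>x\<close> of \<open>u\<close> is unmatched and so has
    a second matched neighbor \<open>s\<close>. By (ii) some vertex has neighborhood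
    \<open>{a, ?p s}\<close>; it is \<open>u\<close> or \<open>u'\<close>. But \<open>u\<close> has
    three neighbors \<open>a\<close>, \<open>v\<close>, \<open>x\<close>, and \<open>u'\<close>
    would give \<open>s = b\<close>, making \<open>x\<close> equal to \<open>v'\<close>, a
    non-neighbor of \<open>u\<close>.\<close>
  have "x \<in> {a, v}" if ux: "(u, x) \<in> parcs G" for x
  proof (rule ccontr)
    assume x: "x \<notin> {a, v}"
    then have "x \<notin> ?S"
      using tight(3)[OF u(1) _ ux] u(2) by blast
    moreover obtain s where s: "(x, s) \<in> parcs G" "s \<noteq> u"
      using ex_other_nbr[OF in_arcsD2[OF ux]] by blast
    ultimately have sS: "s \<in> ?S"
      using tight(2) by blast
    obtain z where z: "nbhd G z = {a, ?p s}"
      using tight(4)[OF u(1) sS _ ux adj_sym[OF s(1)]] s(2) u(2) by auto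
    then have "z \<in> nbhd G a" by (auto simp: nbhd_def intro: adj_sym)
    then consider "z = u" | "z = u'" using a(1) by blast
    then show False
    proof cases
      case 1
      then have "{a, v, x} \<subseteq> {a, ?p s}"
        using z adj' adj ux by (auto simp: nbhd_def)
      then show False using dist x by auto
    next
      case 2
      then have "?p s = v'" using z Nu' dist by (auto simp: doubleton_eq_iff)
      then have "s = b" using mate(4)[OF sS] pv' by simp
      then have "x \<in> nbhd G b" using s adj_sym by (auto simp: nbhd_def)
      then show False using b x nadj ux by auto
    qed
  qed
  then show "nbhd G u = {a, v}"
    using adj adj' by (auto simp: nbhd_def)
qed

text \<open>The conclusions about \<open>b\<close> in the preceding lemma are its hypotheses for the
  hexagon turned by a half-turn. Applied twice, it confines all six neighborhoods to the hexagon,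
  which by connectedness is all of \<open>G\<close>.\<close>

lemma tight_hexagon_partner_C6:
  assumes conn: "connected (with_proj G)" and M: "tight_matching G M"
    and hex: "hexagon G a u v b v' u'"
    and a: "nbhd G a = {u, u'}" "a \<in> matching_verts M" "partner M a = u"
    and b: "nbhd G b = {v, v'}"
  shows "is_C6 G"
proof -
  note half = tight_hexagon_partner_nbhd[OF M hex a b]
  have hex': "hexagon G b v' u' a u v"
    using hexagon_rotate[OF hexagon_rotate[OF hexagon_rotate[OF hex]]] .
  note other = tight_hexagon_partner_nbhd[OF M hex' _ half(1,2)]
  have Nb: "nbhd G b = {v', v}" and Na: "nbhd G a = {u', u}"
    using a b by auto
  have "pverts G = {a, u, v, b, v', u'}"
  proof (rule connected_closed_eq[OF conn, of a])
    show "{a, u, v, b, v', u'} \<subseteq> pverts G" by (rule hexagon_verts[OF hex])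
    fix y z assume "y \<in> {a, u, v, b, v', u'}" and "(y, z) \<in> parcs G"
    then have "z \<in> nbhd G y" by (simp add: nbhd_def)
    with \<open>y \<in> _\<close> show "z \<in> {a, u, v, b, v', u'}"
      using a(1) b half(3,4) other(3,4)[OF Nb] Na by (elim insertE emptyE) auto
  qed simp
  with hex show ?thesis
    unfolding is_C6_iff_hexagon by blast
qed

text \<open>If \<open>a\<close> or \<open>b\<close> were matched, its partner would be a hexagon
  neighbor and, up to reflection and half-turn, the preceding lemma would make \<open>G\<close> a
  C6. So both are unmatched, maximality matches \<open>u\<close> and \<open>v\<close>, and (i) pairs
  these adjacent vertices.\<close>

lemma tight_hexagon_edge:
  assumes conn: "connected (with_proj G)" and nC6: "\<not> is_C6 G"
    and M: "tight_matching G M" and hex: "hexagon G a u v b v' u'"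
    and d2: "a \<in> d2 G" "b \<in> d2 G"
  shows "{u, v} \<in> M"
proof -
  note tight = tight_matchingD[OF M] and mate = matching_partner[OF tight_matchingD(1)[OF M]]
  have adj: "(a, u) \<in> parcs G" "(u, v) \<in> parcs G" "(v, b) \<in> parcs G" "(b, v') \<in> parcs G"
      "(v', u') \<in> parcs G" "(u', a) \<in> parcs G" and ne: "u \<noteq> u'" "v \<noteq> v'"
    using hex by (auto simp: hexagon_def)
  have N: "nbhd G x = {y, z}"
    if "x \<in> d2 G" "(x, y) \<in> parcs G" "(x, z) \<in> parcs G" "y \<noteq> z" for x y z
    using that finite_nbhd[of x]
    by (intro card_seteq[symmetric]) (auto simp: d2_def Defs.degree_def nbhd_def)
  have a: "nbhd G a = {u, u'}" and b: "nbhd G b = {v, v'}"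
    using N[OF d2(1) adj(1) adj_sym[OF adj(6)] ne(1)] N[OF d2(2) adj_sym[OF adj(3)] adj(4) ne(2)] by auto
  have hex_rev: "hexagon G a u' v' b v u"
    by (rule hexagon_reflect[OF hex])
  note rotate3 = hexagon_rotate[THEN hexagon_rotate, THEN hexagon_rotate]
  have "a \<notin> matching_verts M"
  proof
    assume aS: "a \<in> matching_verts M"
    then have "partner M a \<in> nbhd G a"
      using mate(2) by (simp add: nbhd_def)
    then consider "partner M a = u" | "partner M a = u'" using a by blast
    then show False
      using tight_hexagon_partner_C6[OF conn M hex a aS _ b]
        tight_hexagon_partner_C6[OF conn M hex_rev _ aS] a b nC6
      by cases (auto simp: insert_commute)
  qed
  moreover have "b \<notin> matching_verts M"
  proof
    assume bS: "b \<in> matching_verts M"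
    then have "partner M b \<in> nbhd G b"
      using mate(2) by (simp add: nbhd_def)
    then consider "partner M b = v" | "partner M b = v'" using b by blast
    then show False
      using tight_hexagon_partner_C6[OF conn M rotate3[OF hex] _ bS]
        tight_hexagon_partner_C6[OF conn M rotate3[OF hex_rev] _ bS] a b nC6
      by cases (auto simp: insert_commute)
  qed
  ultimately have "u \<in> matching_verts M" "v \<in> matching_verts M"
    using tight(2) adj by blast+
  then show ?thesis
    using mate(1)[of u] tight(3)[OF _ _ adj(2)] by auto
qed

text \<open>Condition (ii) for \<open>u\<close> and \<open>s\<close> gives \<open>z'\<close> joined
  exactly to their partners; the partners now share \<open>z'\<close>, so (ii) gives
  \<open>z\<close> joined exactly to \<open>u\<close> and \<open>s\<close>. These close the two
  matching edges to a hexagon with \<open>z\<close> and \<open>z'\<close> opposite and of degree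
  two.\<close>

lemma tight_share_neighbor_hexagon:
  assumes M: "tight_matching G M"
    and S: "u \<in> matching_verts M" "s \<in> matching_verts M" and ne: "s \<noteq> u" "s \<noteq> partner M u"
    and w: "(u, w) \<in> parcs G" "(s, w) \<in> parcs G"
  shows "{u, partner M u} \<in> M_edges G"
proof -
  let ?S = "matching_verts M" and ?p = "partner M"
  note tight = tight_matchingD[OF M] and mate = matching_partner[OF tight_matchingD(1)[OF M]]
  obtain z' where z': "z' \<in> pverts G" "nbhd G z' = {?p u, ?p s}"
    using tight(4)[OF S ne(1)[symmetric] w] by blast
  have ne': "?p s \<noteq> u" "?p s \<noteq> ?p u"
    using mate(4) S ne by metis+
  have z'adj: "(?p u, z') \<in> parcs G" "(?p s, z') \<in> parcs G"
    using z' by (auto simp: nbhd_def set_eq_iff intro: adj_sym)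
  then obtain z where z: "z \<in> pverts G" "nbhd G z = {u, s}"
    using tight(4)[OF mate(3)[OF S(1)] mate(3)[OF S(2)] ne'(2)[symmetric] z'adj] mate(4) S by auto
  \<comment> \<open>By (i) a matched vertex has only one matched neighbor, so a vertex with two is
    unmatched.\<close>
  have out: "x \<notin> ?S" if "nbhd G x = {y, y'}" "y \<in> ?S" "y' \<in> ?S" "y \<noteq> y'" for x y y'
    using that tight(3)[of x y] tight(3)[of x y'] by (auto simp: nbhd_def set_eq_iff)
  have zS: "z \<notin> ?S" "z' \<notin> ?S"
    using out[OF z(2)] out[OF z'(2)] S mate(3) ne ne' by auto
  have Nz: "\<And>x. (z, x) \<in> parcs G \<longleftrightarrow> x \<in> {u, s}" "\<And>x. (z', x) \<in> parcs G \<longleftrightarrow> x \<in> {?p u, ?p s}"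
    using z(2) z'(2) by (auto simp: nbhd_def)
  have Nz_rev: "\<And>x. (x, z) \<in> parcs G \<longleftrightarrow> x \<in> {u, s}" "\<And>x. (x, z') \<in> parcs G \<longleftrightarrow> x \<in> {?p u, ?p s}"
    using Nz adj_sym by blast+
  have pne: "?p u \<noteq> u" "?p s \<noteq> s"
    using mate(2) S not_adj_self by metis+
  have "hexagon G z u (?p u) z' (?p s) s"
  proof -
    have "(u, ?p s) \<notin> parcs G" "(u, s) \<notin> parcs G" "(?p u, ?p s) \<notin> parcs G" "(?p u, s) \<notin> parcs G"
      using tight(3) mate S ne ne' pne by metis+
    moreover have "distinct [z, u, ?p u, z', ?p s, s]"
      using zS S mate(3) ne ne' pne Nz by auto
    ultimately show ?thesis
      using mate(2)[OF S(1)] adj_sym[OF mate(2)[OF S(2)]] ne ne' pne zS S mate(3)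
      unfolding hexagon_def by (auto simp: Nz Nz_rev)
  qed
  moreover have "z \<in> d2 G" "z' \<in> d2 G"
    using z z' ne ne' by (auto simp: d2_def Defs.degree_def)
  ultimately show ?thesis
    unfolding M_edges_iff_hexagon by blast
qed

text \<open>If \<open>uv\<close> is in \<open>M\<close> but not in \<open>M_edges G\<close>, no
  other matched vertex shares a neighbor with \<open>u\<close> or \<open>v\<close>. Every further
  neighbor of these two is then a page with neighborhood \<open>{u, v}\<close>, and connectedness
  makes \<open>G\<close> a book.\<close>

lemma tight_matching_subset_M_edges:
  assumes conn: "connected (with_proj G)" and nK: "\<not> in_K_family G" and M: "tight_matching G M"
  shows "M \<subseteq> M_edges G"
proof
  let ?S = "matching_verts M" and ?p = "partner M"
  note tight = tight_matchingD[OF M] and mate = matching_partner[OF tight_matchingD(1)[OF M]]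
  fix e assume e: "e \<in> M"
  then obtain u v where uv: "e = {u, v}" "(u, v) \<in> parcs G"
    using tight(1) by (auto simp: matching_def uedges_def)
  have S: "u \<in> ?S" "v \<in> ?S"
    using e uv by (auto simp: matching_verts_def)
  have p: "?p u = v" "?p v = u"
    using tight(3) S uv adj_sym by blast+
  show "e \<in> M_edges G"
  proof (rule ccontr)
    assume not_in: "e \<notin> M_edges G"
    have shared: "s \<in> {u, v}" if "s \<in> ?S" "(x, w) \<in> parcs G" "x \<in> {u, v}" "(w, s) \<in> parcs G" for s x w
      using tight_share_neighbor_hexagon[OF M S(1) that(1)] tight_share_neighbor_hexagon[OF M S(2) that(1)]
        that adj_sym[OF that(4)] not_in uv p by (auto simp: insert_commute)
    define C where "C = {u, v} \<union> {w \<in> pverts G. nbhd G w = {u, v}}"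
    have nb_in: "y \<in> C" if x: "x \<in> {u, v}" and xy: "(x, y) \<in> parcs G" for x y
    proof (cases "y \<in> ?S")
      case True
      then show ?thesis
        using tight(3)[OF _ True xy] x S p by (auto simp: C_def)
    next
      case False
      then have "nbhd G y \<subseteq> {u, v}"
        using shared[OF _ xy x] tight(2) by (auto simp: nbhd_def)
      then show ?thesis
        using nbhd_eqI in_arcsD2[OF xy] by (auto simp: C_def)
    qed
    have "pverts G = C"
    proof (rule connected_closed_eq[OF conn])
      show "u \<in> C" "C \<subseteq> pverts G"
        using uv in_arcsD1 in_arcsD2 by (auto simp: C_def)
      fix y z assume y: "y \<in> C" and yz: "(y, z) \<in> parcs G"
      show "z \<in> C"
      proof (cases "y \<in> {u, v}")
        case False
        then have "z \<in> {u, v}"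
          using y yz by (auto simp: C_def nbhd_def)
        then show ?thesis by (auto simp: C_def)
      qed (rule nb_in[OF _ yz])
    qed
    then have "\<forall>w \<in> pverts G - {u, v}. nbhd G w = {u, v}"
      by (auto simp: C_def)
    \<comment> \<open>The second neighbor of \<open>u\<close> supplies the one page that a book must
      have.\<close>
    moreover obtain z where "(u, z) \<in> parcs G" "z \<noteq> v"
      using ex_other_nbr in_arcsD1[OF uv(2)] by blast
    then have "z \<in> pverts G" "z \<notin> {u, v}"
      using in_arcsD2 not_adj_self by auto
    then have "pverts G \<noteq> {u, v}" by blast
    ultimately show False
      using nK uv(2) in_K_family_iff by blast
  qed
qed

lemma tight_matching_eq_M_edges:
  assumes "connected (with_proj G)" and "\<not> in_K_family G" and "\<not> is_C6 G" and M: "tight_matching G M"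
  shows "M_edges G = M"
proof
  show "M_edges G \<subseteq> M"
  proof
    fix e assume "e \<in> M_edges G"
    then obtain x u v y d d' where "hexagon G x u v y d d'" "x \<in> d2 G" "y \<in> d2 G" "e = {u, v}"
      unfolding M_edges_iff_hexagon by blast
    then show "e \<in> M"
      using tight_hexagon_edge[OF assms(1,3,4)] by simp
  qed
qed (rule tight_matching_subset_M_edges[OF assms(1,2,4)])

section \<open>Tight matchings in the exceptional graphs\<close>

lemma in_K_family_tight_matching:
  assumes "in_K_family G"
  shows "\<exists>M. tight_matching G M"
proof -
  obtain u v where uv: "(u, v) \<in> parcs G" and ne: "pverts G \<noteq> {u, v}"
    and nb: "\<And>w. w \<in> pverts G - {u, v} \<Longrightarrow> nbhd G w = {u, v}"
    using assms in_K_family_iff by blast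
  have "u \<in> pverts G" "v \<in> pverts G" "u \<noteq> v"
    using uv in_arcsD1 in_arcsD2 not_adj_self by auto
  then obtain w where w: "w \<in> pverts G" "w \<notin> {u, v}"
    using ne by blast
  \<comment> \<open>The spine alone is a tight matching: the partners of \<open>u\<close> and
    \<open>v\<close> are each other, and any page is the witness for (ii).\<close>
  let ?M = "{{u, v}}"
  have M: "matching G ?M"
    using uv by (auto simp: matching_def uedges_iff)
  have verts: "matching_verts ?M = {u, v}"
    by (simp add: matching_verts_def)
  have p: "partner ?M u = v" "partner ?M v = u"
    using matching_partner_eq[OF M] by (auto simp: insert_commute)
  have "maximal_matching G ?M"
  proof -
    have "x \<in> {u, v} \<or> y \<in> {u, v}" if xy: "(x, y) \<in> parcs G" for x y
    proof (cases "x \<in> {u, v}")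
      case False
      then have "nbhd G x = {u, v}" using nb in_arcsD1[OF xy] by blast
      then show ?thesis using xy by (auto simp: nbhd_def)
    qed blast
    then show ?thesis
      using M by (auto simp: maximal_matching_iff_cover verts)
  qed
  moreover have "nbhd G u \<inter> {u, v} = {v}" "nbhd G v \<inter> {u, v} = {u}"
    using uv adj_sym not_adj_self by (auto simp: nbhd_def)
  moreover have "nbhd G w = {u, v}" "nbhd G w = {v, u}"
    using nb w by auto
  ultimately have "tight_matching G ?M"
    using w(1) unfolding tight_matching_def verts by (auto simp: p)
  then show ?thesis by blast
qed

lemma is_C6_tight_matching:
  assumes "is_C6 G"
  shows "\<exists>M. tight_matching G M"
proof -
  obtain a b c d e f where hex: "hexagon G a b c d e f" and V: "pverts G = {a, b, c, d, e, f}"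
    using assms is_C6_iff_hexagon by blast
  have dist: "distinct [a, b, c, d, e, f]"
    and adj: "(a, b) \<in> parcs G" "(d, e) \<in> parcs G"
    using hex by (auto simp: hexagon_def)
  have N: "nbhd G a = {b, f}" "nbhd G b = {c, a}" "nbhd G c = {d, b}" "nbhd G d = {e, c}"
    "nbhd G e = {f, d}" "nbhd G f = {a, e}"
  proof -
    note r1 = hexagon_rotate[OF hex] note r2 = hexagon_rotate[OF r1] note r3 = hexagon_rotate[OF r2]
    note r4 = hexagon_rotate[OF r3] note r5 = hexagon_rotate[OF r4]
    show "nbhd G a = {b, f}" by (rule hexagon_nbhd_within[OF hex V])
    show "nbhd G b = {c, a}" by (rule hexagon_nbhd_within[OF r1]) (unfold V, blast)
    show "nbhd G c = {d, b}" by (rule hexagon_nbhd_within[OF r2]) (unfold V, blast)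
    show "nbhd G d = {e, c}" by (rule hexagon_nbhd_within[OF r3]) (unfold V, blast)
    show "nbhd G e = {f, d}" by (rule hexagon_nbhd_within[OF r4]) (unfold V, blast)
    show "nbhd G f = {a, e}" by (rule hexagon_nbhd_within[OF r5]) (unfold V, blast)
  qed
  \<comment> \<open>Two opposite edges; the unmatched vertices \<open>c\<close> and \<open>f\<close>
    will be the witnesses for (ii).\<close>
  let ?M = "{{a, b}, {d, e}}"
  have M: "matching G ?M"
    using adj dist by (auto simp: matching_def uedges_iff pairwise_def disjnt_def)
  have verts: "matching_verts ?M = {a, b, d, e}"
    by (auto simp: matching_verts_def)
  have p: "partner ?M a = b" "partner ?M b = a" "partner ?M d = e" "partner ?M e = d"
    using matching_partner_eq[OF M] by (auto simp: insert_commute)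
  have "maximal_matching G ?M"
  proof -
    have "x \<in> {a, b, d, e} \<or> y \<in> {a, b, d, e}" if xy: "(x, y) \<in> parcs G" for x y
    proof -
      have "x \<in> {a, b, c, d, e, f}" "y \<in> nbhd G x"
        using in_arcsD1[OF xy] xy V by (auto simp: nbhd_def)
      then show ?thesis using N by (elim insertE emptyE) auto
    qed
    then show ?thesis
      using M by (auto simp: maximal_matching_iff_cover verts)
  qed
  moreover have "\<forall>v \<in> {a, b, d, e}. nbhd G v \<inter> {a, b, d, e} = {partner ?M v}"
    using dist by (simp add: N p) blast
  moreover have "\<exists>w \<in> pverts G. nbhd G w = {partner ?M x, partner ?M y}"
    if xy: "x \<in> {a, b, d, e}" "y \<in> {a, b, d, e}" "x \<noteq> y" "nbhd G x \<inter> nbhd G y \<noteq> {}" for x y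
  proof -
    \<comment> \<open>Matched vertices with a common neighbor: \<open>a\<close> and \<open>e\<close>
      share \<open>f\<close> and have witness \<open>c\<close>, while \<open>b\<close> and
      \<open>d\<close> share \<open>c\<close> and have witness \<open>f\<close>.\<close>
    have "x = a \<and> y = e \<or> x = e \<and> y = a \<or> x = b \<and> y = d \<or> x = d \<and> y = b"
    proof -
      have "nbhd G a \<inter> nbhd G b = {}" "nbhd G a \<inter> nbhd G d = {}"
        "nbhd G b \<inter> nbhd G e = {}" "nbhd G d \<inter> nbhd G e = {}"
        unfolding N using dist by auto
      then show ?thesis
        using xy by blast
    qed
    then have "nbhd G c = {partner ?M x, partner ?M y} \<or> nbhd G f = {partner ?M x, partner ?M y}"
      by (elim disjE conjE) (simp_all add: N p insert_commute)
    then show ?thesis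
      unfolding V by blast
  qed
  ultimately have "tight_matching G ?M"
    unfolding tight_matching_def verts by blast
  then show ?thesis by blast
qed

end

theorem theorem2p8:
  fixes G :: "'a pair_pre_digraph"
  assumes "pair_graph G"
    and "connected (with_proj G)"
    and "min_degree G = 2"
  shows "total_domination_number G = 2 * min_maximal_matching_number G \<longleftrightarrow>
    (in_K_family G \<or> is_C6 G) \<or>
    (\<not> (in_K_family G \<or> is_C6 G) \<and>
     maximal_matching G (M_edges G) \<and>
     (\<forall>v \<in> matching_verts (M_edges G).
        nbhd G v \<inter> matching_verts (M_edges G) = {partner (M_edges G) v}) \<and>
     (\<forall>u \<in> matching_verts (M_edges G). \<forall>v \<in> matching_verts (M_edges G).
        u \<noteq> v \<longrightarrow> nbhd G u \<inter> nbhd G v \<noteq> {} \<longrightarrow>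
        (\<exists>w \<in> pverts G. nbhd G w = {partner (M_edges G) u, partner (M_edges G) v})))"
proof -
  interpret pair_graph G by fact
  have "2 \<le> Defs.degree G v" if "v \<in> pverts G" for v
    using assms(3) that pair_finite_verts Min_le[of "Defs.degree G ` pverts G" "Defs.degree G v"]
    by (simp add: min_degree_def)
  then interpret min_degree_two_graph G
    by unfold_locales
  \<comment> \<open>In the exceptional graphs both sides hold. Otherwise a tight matching can only
    be \<open>M_edges G\<close>, so its existence amounts to tightness of that set.\<close>
  show ?thesis
    unfolding domination_eq_iff_tight_matching tight_matching_def[of G "M_edges G", symmetric]
    using in_K_family_tight_matching is_C6_tight_matching tight_matching_eq_M_edges[OF assms(2)]
    by metis
qed

end
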